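(* Let $n\ge 3$ and let $K_n\setminus\{e_{1,n}\}$ be the graph obtained from the complete graph $K_n$ on $[n]$ by deleting the edge $\{1,n\}$. For a vertex $r$, let $\mathcal{T}'_r$ be the set of uprooted spanning trees of $K_n\setminus\{e_{1,n}\}$ with root $r$. Then \[|\mathcal{T}'_n| = n^{n-3}(n-2),\] and for $1\le k\le n-2$, \[|\mathcal{T}'_{n-k}| = n^{n-2-k}\,(n-1)^{k-1}\left((n-3-k)+\frac{2nk+n-k-2}{n(n-1)}\right).\]
   Context: An uprooted spanning tree with root $r$ is a spanning tree with distinguished root $r$ in which $r$ is greater than all of its children (i.e., all its neighbours in the tree). *)

theory Defs
  imports Complex_Main
begin

(* Undirected graphs: a vertex set together with a set of edges, an edge being a
   two-element set of vertices.  The tree notion of the AFP entry Graph_Theory is not used,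
   because it only excludes directed cycles. *)
type_synonym 'a graph = "'a set \<times> 'a set set"

abbreviation vertices :: "'a graph \<Rightarrow> 'a set" where
  "vertices G \<equiv> fst G"

abbreviation edges :: "'a graph \<Rightarrow> 'a set set" where
  "edges G \<equiv> snd G"

definition simple_graph :: "'a graph \<Rightarrow> bool" where
  "simple_graph G \<longleftrightarrow>
     finite (vertices G) \<and> (\<forall>e \<in> edges G. e \<subseteq> vertices G \<and> card e = 2)"

(* A walk is given by its nonempty list of vertices. *)
definition graph_walk :: "'a graph \<Rightarrow> 'a list \<Rightarrow> bool" where
  "graph_walk G p \<longleftrightarrow>
     p \<noteq> [] \<and> set p \<subseteq> vertices G \<and> successively (\<lambda>u v. {u, v} \<in> edges G) p"

definition graph_connected :: "'a graph \<Rightarrow> bool" where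
  "graph_connected G \<longleftrightarrow>
     vertices G \<noteq> {} \<and>
     (\<forall>u \<in> vertices G. \<forall>v \<in> vertices G. \<exists>p. graph_walk G p \<and> hd p = u \<and> last p = v)"

(* A cycle is given by its list of distinct vertices, without repeating the first one;
   the closing edge joins the last vertex to the first. *)
definition graph_cycle :: "'a graph \<Rightarrow> 'a list \<Rightarrow> bool" where
  "graph_cycle G p \<longleftrightarrow>
     graph_walk G p \<and> 3 \<le> length p \<and> distinct p \<and> {last p, hd p} \<in> edges G"

definition graph_tree :: "'a graph \<Rightarrow> bool" where
  "graph_tree G \<longleftrightarrow> simple_graph G \<and> graph_connected G \<and> (\<nexists>p. graph_cycle G p)"

definition spanning_tree_of :: "'a graph \<Rightarrow> 'a graph \<Rightarrow> bool" where
  "spanning_tree_of G T \<longleftrightarrow>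
     graph_tree T \<and> vertices T = vertices G \<and> edges T \<subseteq> edges G"

(* The children of the root are exactly its neighbours in the tree. *)
definition uprooted_spanning_tree :: "'a::linorder graph \<Rightarrow> 'a graph \<Rightarrow> 'a \<Rightarrow> bool" where
  "uprooted_spanning_tree G T r \<longleftrightarrow>
     spanning_tree_of G T \<and> r \<in> vertices T \<and>
     (\<forall>v \<in> vertices T. {r, v} \<in> edges T \<longrightarrow> v < r)"

(* Since the root is fixed, a rooted tree is identified with its underlying tree. *)
definition uprooted_spanning_trees :: "'a::linorder graph \<Rightarrow> 'a \<Rightarrow> 'a graph set" where
  "uprooted_spanning_trees G r = {T. uprooted_spanning_tree G T r}"

definition complete_graph :: "nat \<Rightarrow> nat graph" where
  "complete_graph n = ({1..n}, {e. e \<subseteq> {1..n} \<and> card e = 2})"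

definition delete_edge :: "'a graph \<Rightarrow> 'a set \<Rightarrow> 'a graph" where
  "delete_edge G e = (vertices G, edges G - {e})"

end

theory Submission
  imports Defs
begin

text \<open>
  Let \<open>F\<close> be a forest on \<open>n\<close> vertices with \<open>m\<close> components, of sizes \<open>c\<^sub>1, \<dots>, c\<^sub>m\<close>. The number of
  spanning trees of \<open>K\<^sub>n\<close> containing \<open>F\<close> is \<open>n\<^bsup>m-2\<^esup> c\<^sub>1 \<cdots> c\<^sub>m\<close>: counting pairs of such a tree and one
  of its \<open>m - 1\<close> edges outside \<open>F\<close> gives a recursion on \<open>m\<close>, because the edges joining two components
  of sizes \<open>a\<close> and \<open>b\<close> number \<open>a b\<close>, and each of them replaces the factor \<open>a b\<close> by \<open>a + b\<close>.

  The uprooted trees with root \<open>r\<close> are the spanning trees that avoid the edge \<open>{1, n}\<close> and the star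
  joining \<open>r\<close> to \<open>r + 1, \<dots>, n\<close>. Forbidden edges are turned into prescribed ones with
  \<open>M(E, D \<union> {e}) = M(E, D) - M(E \<union> {e}, D)\<close>, where \<open>M(E, D)\<close> counts the spanning trees that contain \<open>E\<close>
  and avoid \<open>D\<close>; along a star this recursion has a closed form.
\<close>

subsection \<open>Connected components\<close>

definition adj :: "'a set set \<Rightarrow> ('a \<times> 'a) set" where
  "adj E = {(u, v). {u, v} \<in> E}"

text \<open>No ambient vertex set enters: a vertex that no edge touches is its own singleton
  component, which is how isolated vertices appear below.\<close>

definition component :: "'a set set \<Rightarrow> 'a \<Rightarrow> 'a set" where
  "component E u = (adj E)\<^sup>* `` {u}"

lemma component_self [simp]: "u \<in> component E u"
  by (simp add: component_def)

lemma sym_conn: "sym ((adj E)\<^sup>*)"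
  by (intro sym_rtrancl) (auto simp: adj_def sym_def insert_commute)

lemma component_sym: "v \<in> component E u \<Longrightarrow> u \<in> component E v"
  using sym_conn[of E] by (auto simp: component_def sym_def)

lemma component_trans: "v \<in> component E u \<Longrightarrow> w \<in> component E v \<Longrightarrow> w \<in> component E u"
  by (auto simp: component_def)

lemma component_eq_iff: "component E u = component E v \<longleftrightarrow> v \<in> component E u"
  by (auto intro: component_sym component_trans)

lemma component_disjoint: "v \<notin> component E u \<Longrightarrow> component E u \<inter> component E v = {}"
  by (auto intro: component_sym component_trans)

lemma component_edge: "{u, v} \<in> E \<Longrightarrow> v \<in> component E u"
  by (auto simp: component_def adj_def)

lemma component_mono: "E \<subseteq> F \<Longrightarrow> component E u \<subseteq> component F u"
  unfolding component_def by (intro Image_mono rtrancl_mono) (auto simp: adj_def)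

lemma component_empty [simp]: "component {} u = {u}"
  by (simp add: component_def adj_def)

lemma component_closed_subset:
  assumes "u \<in> S" "\<And>x y. x \<in> S \<Longrightarrow> {x, y} \<in> E \<Longrightarrow> y \<in> S"
  shows "component E u \<subseteq> S"
proof
  fix w assume "w \<in> component E u"
  hence "(u, w) \<in> (adj E)\<^sup>*" by (simp add: component_def)
  thus "w \<in> S" by induction (use assms in \<open>auto simp: adj_def\<close>)
qed

lemma component_insert_outside:
  assumes "u \<notin> component E a" "v \<notin> component E a"
  shows "component (insert {u, v} E) a = component E a"
proof
  show "component (insert {u, v} E) a \<subseteq> component E a"
  proof (rule component_closed_subset)
    fix x y assume "x \<in> component E a" "{x, y} \<in> insert {u, v} E"
    moreover have "{x, y} \<noteq> {u, v}" using assms \<open>x \<in> component E a\<close> by (auto simp: doubleton_eq_iff)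
    ultimately show "y \<in> component E a" using component_edge component_trans by fast
  qed simp
qed (intro component_mono, auto)

lemma component_insert_endpoint: "component (insert {u, v} E) u = component E u \<union> component E v"
proof
  show "component (insert {u, v} E) u \<subseteq> component E u \<union> component E v"
  proof (rule component_closed_subset)
    fix x y assume xy: "x \<in> component E u \<union> component E v" "{x, y} \<in> insert {u, v} E"
    show "y \<in> component E u \<union> component E v"
    proof (cases "{x, y} \<in> E")
      case True thus ?thesis using xy component_edge component_trans by fast
    next
      case False thus ?thesis using xy by (auto simp: doubleton_eq_iff)
    qed
  qed simp
  have "component E v \<subseteq> component (insert {u, v} E) v" by (intro component_mono) auto
  moreover have "v \<in> component (insert {u, v} E) u" by (intro component_edge) auto
  moreover have "component E u \<subseteq> component (insert {u, v} E) u" by (intro component_mono) auto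
  ultimately show "component E u \<union> component E v \<subseteq> component (insert {u, v} E) u"
    using component_trans by fast
qed

text \<open>The new edge merges the components of its ends and leaves all others alone. If the ends
  were already connected, the union collapses and nothing changes.\<close>

lemma component_insert:
  "component (insert {u, v} E) a =
     (if a \<in> component E u \<union> component E v then component E u \<union> component E v else component E a)"
proof (cases "a \<in> component E u \<union> component E v")
  case True
  hence "a \<in> component (insert {u, v} E) u" by (simp add: component_insert_endpoint)
  thus ?thesis using True component_eq_iff component_insert_endpoint by metis
next
  case False
  thus ?thesis using component_insert_outside component_sym by (metis UnI1 UnI2)
qed

section \<open>Walks and simple paths inside a component\<close>

lemma walk_component:
  "p \<noteq> [] \<Longrightarrow> successively (\<lambda>u v. {u, v} \<in> E) p \<Longrightarrow> last p \<in> component E (hd p)"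
proof (induction p)
  case (Cons a p)
  show ?case
  proof (cases p)
    case (Cons b q)
    hence "last p \<in> component E b" "{a, b} \<in> E" using Cons.IH Cons.prems by auto
    thus ?thesis using Cons component_edge component_trans by fastforce
  qed simp
qed simp

lemma component_path:
  assumes "v \<in> component E u"
  obtains p where "p \<noteq> []" "hd p = u" "last p = v" "distinct p"
    "successively (\<lambda>x y. {x, y} \<in> E) p" "set p \<subseteq> component E u"
proof -
  have "(u, v) \<in> (adj E)\<^sup>*" using assms by (simp add: component_def)
  hence "\<exists>p. p \<noteq> [] \<and> hd p = u \<and> last p = v \<and> distinct p \<and>
      successively (\<lambda>x y. {x, y} \<in> E) p \<and> set p \<subseteq> component E u"
  proof induction
    case base
    show ?case by (intro exI[of _ "[u]"]) auto
  next
    case (step y z)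
    then obtain p where p: "p \<noteq> []" "hd p = u" "last p = y" "distinct p"
      "successively (\<lambda>x y. {x, y} \<in> E) p" "set p \<subseteq> component E u" by blast
    show ?case
    proof (cases "z \<in> set p")
      \<comment> \<open>The path already visits \<open>z\<close>; cutting it there keeps its
        vertices distinct.\<close>
      case True
      then obtain xs ys where "p = xs @ z # ys" by (meson split_list)
      thus ?thesis using p
        by (intro exI[of _ "xs @ [z]"]) (auto simp: successively_append_iff hd_append split: if_splits)
    next
      case False
      have "z \<in> component E u" using step by (auto simp: component_def)
      thus ?thesis using p False step.hyps
        by (intro exI[of _ "p @ [z]"]) (auto simp: successively_append_iff adj_def)
    qed
  qed
  thus ?thesis using that by blast
qed

text \<open>Acyclicity in terms of connectivity: every edge is a bridge. This also rules out loops,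
  since \<^term>\<open>u \<in> component E u\<close> always holds.\<close>

definition bridged :: "'a set set \<Rightarrow> bool" where
  "bridged E \<longleftrightarrow> (\<forall>u v. {u, v} \<in> E \<longrightarrow> v \<notin> component (E - {{u, v}}) u)"

lemma bridged_empty [simp]: "bridged {}"
  by (simp add: bridged_def)

text \<open>\<open>F\<close> lies inside \<open>E\<close> without \<open>{u, v}\<close>, and
  components only grow with the edge set. Used to see that each edge of a tree outside a subforest
  joins two components of that subforest.\<close>

lemma bridged_new_edge:
  assumes "bridged E" "F \<subseteq> E" "{u, v} \<in> E - F"
  shows "v \<notin> component F u"
proof -
  have "v \<notin> component (E - {{u, v}}) u" using assms by (auto simp: bridged_def)
  moreover have "component F u \<subseteq> component (E - {{u, v}}) u" using assms by (intro component_mono) auto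
  ultimately show ?thesis by blast
qed

lemma bridged_subset:
  assumes "bridged E" "F \<subseteq> E"
  shows "bridged F"
  unfolding bridged_def
proof (intro allI impI)
  fix u v assume "{u, v} \<in> F"
  thus "v \<notin> component (F - {{u, v}}) u" using assms by (intro bridged_new_edge[of E]) auto
qed

lemma bridged_insert:
  assumes "bridged E" "v \<notin> component E u"
  shows "bridged (insert {u, v} E)"
  unfolding bridged_def
proof (intro allI impI notI)
  fix a b
  assume ab: "{a, b} \<in> insert {u, v} E" and b: "b \<in> component (insert {u, v} E - {{a, b}}) a"
  have uvE: "{u, v} \<notin> E" using assms component_edge by fast
  show False
  proof (cases "{a, b} = {u, v}")
    case True
    hence "b \<in> component E a" using b uvE by simp
    thus False using True assms by (auto simp: doubleton_eq_iff dest: component_sym)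
  next
    case False
    define F where "F = E - {{a, b}}"
    have F: "insert {u, v} E - {{a, b}} = insert {u, v} F" using False by (auto simp: F_def)
    have abE: "{a, b} \<in> E" using False ab by auto
    have nb: "b \<notin> component F a" using assms abE by (auto simp: bridged_def F_def)
    \<comment> \<open>If \<open>a\<close> and \<open>b\<close> become connected without their own
      edge, the connection uses \<open>{u, v}\<close>, so both lie in the merged component, one on
      the side of \<open>u\<close> and one on the side of \<open>v\<close>. The old edge
      \<open>{a, b}\<close> would then connect \<open>u\<close> to \<open>v\<close> in
      \<open>E\<close>.\<close>
    have "a \<in> component F u \<union> component F v"
      using b nb F by (auto simp: component_insert split: if_splits)
    moreover have "b \<in> component F u \<union> component F v"
      using b nb F calculation by (auto simp: component_insert split: if_splits)
    moreover have "x \<in> component E y" if "x \<in> component F y" for x y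
      using that component_mono[of F E] by (auto simp: F_def)
    ultimately show False
      using nb assms(2) component_edge[OF abE] component_sym component_trans by (metis UnE)
  qed
qed

section \<open>The partition into components and its change under a new edge\<close>

definition components :: "'a set \<Rightarrow> 'a set set \<Rightarrow> 'a set set" where
  "components V E = component E ` V"

lemma components_insert:
  assumes "u \<in> V" "v \<in> V"
  shows "components V (insert {u, v} E) =
           insert (component E u \<union> component E v) (components V E - {component E u, component E v})"
proof -
  have 1: "a \<in> component E u \<union> component E v \<longleftrightarrow> component E a \<in> {component E u, component E v}" for a
    using component_eq_iff by (metis Un_iff insert_iff empty_iff)
  have "components V (insert {u, v} E) =
      (\<lambda>a. if component E a \<in> {component E u, component E v} then component E u \<union> component E v else component E a) ` V"
    unfolding components_def component_insert 1 ..
  also have "\<dots> = insert (component E u \<union> component E v) (components V E - {component E u, component E v})"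
    unfolding components_def using assms by (auto simp: image_iff)
  finally show ?thesis .
qed

text \<open>Guarantees that the merged class is a genuinely new element, so that cardinalities and
  products over the components gain exactly one term.\<close>

lemma components_merge_new:
  assumes "v \<notin> component E u"
  shows "component E u \<union> component E v \<notin> components V E"
proof
  assume "component E u \<union> component E v \<in> components V E"
  then obtain w where "component E w = component E u \<union> component E v" by (auto simp: components_def)
  hence "u \<in> component E w" "v \<in> component E w" by auto
  thus False using assms component_sym component_trans by fast
qed

subsection \<open>Forests and the number of trees containing them\<close>

definition all_edges :: "'a set \<Rightarrow> 'a set set" where
  "all_edges V = {e. e \<subseteq> V \<and> card e = 2}"

lemma all_edges_doubleton: "{u, v} \<in> all_edges V \<longleftrightarrow> u \<in> V \<and> v \<in> V \<and> u \<noteq> v"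
  by (auto simp: all_edges_def card_2_iff doubleton_eq_iff)

lemma all_edgesE:
  assumes "e \<in> all_edges V"
  obtains u v where "e = {u, v}" "u \<in> V" "v \<in> V" "u \<noteq> v"
  using assms by (auto simp: all_edges_def card_2_iff)

locale vertex_set =
  fixes V :: "'a set"
  assumes finite_V: "finite V"
begin

definition forest :: "'a set set \<Rightarrow> bool" where
  "forest E \<longleftrightarrow> E \<subseteq> all_edges V \<and> bridged E"

text \<open>Connectedness is a component count, so that trees are the end of the recursion on the
  number of components.\<close>

definition tree :: "'a set set \<Rightarrow> bool" where
  "tree E \<longleftrightarrow> forest E \<and> card (components V E) = 1"

definition size_prod :: "'a set set \<Rightarrow> nat" where
  "size_prod E = (\<Prod>C\<in>components V E. card C)"

lemma finite_all_edges: "finite (all_edges V)"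
  using finite_V by (auto simp: all_edges_def)

lemma forest_empty [simp]: "forest {}"
  by (simp add: forest_def)

lemma finite_forest: "forest E \<Longrightarrow> finite E"
  unfolding forest_def by (blast intro: finite_subset[OF _ finite_all_edges])

lemma forest_subset: "forest E \<Longrightarrow> F \<subseteq> E \<Longrightarrow> forest F"
  unfolding forest_def by (blast intro: bridged_subset)

lemma forest_insert:
  assumes "forest E" "u \<in> V" "v \<in> V" "v \<notin> component E u"
  shows "forest (insert {u, v} E)"
  using assms bridged_insert[of E v u] by (auto simp: forest_def all_edges_doubleton)

lemma finite_components: "finite (components V E)"
  using finite_V by (simp add: components_def)

lemma component_subset_V:
  assumes "E \<subseteq> all_edges V" "u \<in> V"
  shows "component E u \<subseteq> V"
  by (rule component_closed_subset) (use assms in \<open>auto simp: all_edges_doubleton\<close>)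

lemma finite_component: "E \<subseteq> all_edges V \<Longrightarrow> u \<in> V \<Longrightarrow> finite (component E u)"
  by (rule finite_subset[OF component_subset_V finite_V])

lemma card_component_pos: "E \<subseteq> all_edges V \<Longrightarrow> u \<in> V \<Longrightarrow> card (component E u) > 0"
  using component_self[of u E] finite_component[of E u] unfolding card_gt_0_iff by blast

lemma card_components_insert:
  assumes "u \<in> V" "v \<in> V" "v \<notin> component E u"
  shows "card (components V E) = Suc (card (components V (insert {u, v} E)))"
proof -
  have ne: "component E u \<noteq> component E v" using assms component_eq_iff by metis
  have sub: "{component E u, component E v} \<subseteq> components V E" using assms by (auto simp: components_def)
  have "card (components V E - {component E u, component E v}) = card (components V E) - 2"
    using ne sub finite_components[of E] by (subst card_Diff_subset) auto
  moreover have "card {component E u, component E v} \<le> card (components V E)"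
    using sub finite_components by (rule card_mono[rotated])
  ultimately show ?thesis
    using ne components_insert[OF assms(1,2), of E] components_merge_new[OF assms(3), of V] finite_components[of E]
    by (simp add: card_insert_if)
qed

text \<open>Only the factors of the two merged components change. The cross-multiplied form keeps
  the identity in the natural numbers.\<close>

lemma size_prod_insert:
  assumes "E \<subseteq> all_edges V" "u \<in> V" "v \<in> V" "v \<notin> component E u"
  shows "size_prod (insert {u, v} E) * (card (component E u) * card (component E v)) =
           size_prod E * (card (component E u) + card (component E v))"
proof -
  have ne: "component E u \<noteq> component E v" using assms component_eq_iff by metis
  have sub: "{component E u, component E v} \<subseteq> components V E" using assms by (auto simp: components_def)
  let ?Q = "\<Prod>C\<in>components V E - {component E u, component E v}. card C"
  have "size_prod E = ?Q * (card (component E u) * card (component E v))"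
    unfolding size_prod_def using ne by (subst prod.subset_diff[OF sub finite_components]) simp
  moreover have "size_prod (insert {u, v} E) = card (component E u \<union> component E v) * ?Q"
    unfolding size_prod_def components_insert[OF assms(2,3)]
    using finite_components[of E] components_merge_new[OF assms(4), of V] by (subst prod.insert) auto
  moreover have "card (component E u \<union> component E v) = card (component E u) + card (component E v)"
    using assms finite_component component_disjoint[OF assms(4)] by (intro card_Un_disjoint) auto
  ultimately show ?thesis by simp
qed

lemma components_empty: "components V {} = (\<lambda>u. {u}) ` V"
  by (simp add: components_def)

lemma card_components_empty: "card (components V {}) = card V"
  by (simp add: components_empty card_image)

lemma size_prod_empty: "size_prod {} = 1"
  unfolding size_prod_def components_empty by (intro prod.neutral) auto

text \<open>Induction on the number of edges: every edge is a bridge, so deleting one splits a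
  component in two.\<close>

lemma card_forest: "forest E \<Longrightarrow> card E + card (components V E) = card V"
proof (induction "card E" arbitrary: E)
  case 0
  hence "E = {}" using finite_forest by auto
  thus ?case by (simp add: card_components_empty)
next
  case (Suc k)
  then obtain e where e: "e \<in> E" by fastforce
  then obtain u v where uv: "e = {u, v}" "u \<in> V" "v \<in> V" "u \<noteq> v"
    using Suc.prems all_edgesE unfolding forest_def by blast
  define F where "F = E - {e}"
  have E: "E = insert {u, v} F" using e uv by (auto simp: F_def)
  have F: "forest F" using Suc.prems forest_subset by (auto simp: F_def)
  have cF: "card F = k" using Suc.hyps(2) e finite_forest[OF Suc.prems] by (simp add: F_def)
  have "v \<notin> component F u" using Suc.prems e uv by (auto simp: forest_def bridged_def F_def)
  hence "card (components V F) = Suc (card (components V E))" unfolding E using uv by (intro card_components_insert)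
  thus ?case using Suc.hyps(1)[OF cF[symmetric] F] cF Suc.hyps(2) by simp
qed

section \<open>Double counting of trees that contain a given forest\<close>

definition trees_containing :: "'a set set \<Rightarrow> 'a set set set" where
  "trees_containing E = {T. tree T \<and> E \<subseteq> T}"

lemma finite_trees_containing: "finite (trees_containing E)"
  by (rule finite_subset[of _ "Pow (all_edges V)"])
     (auto simp: trees_containing_def tree_def forest_def finite_all_edges)

text \<open>Candidate edges are handled below as ordered pairs of vertices, so each edge is counted
  once per orientation.\<close>

lemma card_edge_orientations:
  assumes "A \<subseteq> all_edges V"
  shows "card {(u, v). {u, v} \<in> A} = 2 * card A"
proof -
  have fA: "finite A" using assms finite_all_edges finite_subset by blast
  have "{(u, v). {u, v} \<in> A} = (\<Union>e\<in>A. {(u, v). {u, v} = e})" by auto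
  also have "card \<dots> = (\<Sum>e\<in>A. card {(u, v). {u, v} = e})"
  proof (rule card_UN_disjoint[OF fA])
    show "\<forall>e\<in>A. finite {(u, v). {u, v} = e}"
    proof
      fix e assume "e \<in> A"
      then obtain a b where "e = {a, b}" using assms all_edgesE by blast
      hence "{(u, v). {u, v} = e} \<subseteq> {(a, b), (b, a)}" by (auto simp: doubleton_eq_iff)
      thus "finite {(u, v). {u, v} = e}" using finite_subset by blast
    qed
  qed auto
  also have "\<dots> = (\<Sum>e\<in>A. 2)"
  proof (rule sum.cong[OF refl])
    fix e assume "e \<in> A"
    then obtain a b where "e = {a, b}" "a \<noteq> b" using assms all_edgesE by blast
    hence "{(u, v). {u, v} = e} = {(a, b), (b, a)}" by (auto simp: doubleton_eq_iff)
    thus "card {(u, v). {u, v} = e} = 2" using \<open>a \<noteq> b\<close> by simp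
  qed
  finally show ?thesis by simp
qed

text \<open>A component of size \<open>c\<close> contributes \<open>c\<close> summands equal to
  \<open>1 / c\<close>.\<close>

lemma sum_inverse_card_component:
  assumes "E \<subseteq> all_edges V"
  shows "(\<Sum>u\<in>V. 1 / real (card (component E u))) = card (components V E)"
proof -
  have "(\<Sum>u\<in>V. 1 / real (card (component E u))) =
      (\<Sum>C\<in>component E ` V. \<Sum>u\<in>{x\<in>V. component E x = C}. 1 / real (card (component E u)))"
    by (rule sum.image_gen[OF finite_V])
  also have "\<dots> = (\<Sum>C\<in>component E ` V. 1)"
  proof (rule sum.cong[OF refl])
    fix C assume "C \<in> component E ` V"
    then obtain w where w: "w \<in> V" "C = component E w" by auto
    have "{x\<in>V. component E x = C} = C"
      using component_subset_V[OF assms w(1)] unfolding w(2)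
      by (auto simp: component_eq_iff dest: component_sym)
    moreover have "(\<Sum>u\<in>{x\<in>V. component E x = C}. 1 / real (card (component E u))) =
        (\<Sum>u\<in>{x\<in>V. component E x = C}. 1 / real (card C))" by (rule sum.cong) auto
    ultimately show "(\<Sum>u\<in>{x\<in>V. component E x = C}. 1 / real (card (component E u))) = 1"
      using card_component_pos[OF assms w(1)] w by simp
  qed
  finally show ?thesis by (simp add: components_def)
qed

text \<open>The ends of the edges that may extend the forest. The pairs are ordered, whence the
  factors 2 in the counts that follow.\<close>

definition separated :: "'a set set \<Rightarrow> ('a \<times> 'a) set" where
  "separated E = (SIGMA u:V. V - component E u)"

text \<open>For fixed \<open>u\<close> there are \<open>card V - card (component E u)\<close>
  choices of \<open>v\<close>, so the first summand adds up to
  \<open>card V / card (component E u) - 1\<close>. Summing over \<open>u\<close> gives half of the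
  total; swapping the pair gives the other half.\<close>

lemma sum_separated:
  assumes "E \<subseteq> all_edges V"
  shows "(\<Sum>(u, v)\<in>separated E. 1 / real (card (component E u)) + 1 / real (card (component E v))) =
           2 * real (card V) * (real (card (components V E)) - 1)"
proof -
  let ?f = "\<lambda>u. 1 / real (card (component E u))"
  have half: "(\<Sum>(u, v)\<in>separated E. ?f u) = real (card V) * (real (card (components V E)) - 1)"
  proof -
    have "(\<Sum>(u, v)\<in>separated E. ?f u) = (\<Sum>u\<in>V. \<Sum>v\<in>V - component E u. ?f u)"
      unfolding separated_def using finite_V by (subst sum.Sigma) auto
    also have "\<dots> = (\<Sum>u\<in>V. real (card V) * ?f u - 1)"
    proof (rule sum.cong[OF refl])
      fix u assume u: "u \<in> V"
      have "card (V - component E u) = card V - card (component E u)" "card (component E u) \<le> card V"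
        using component_subset_V[OF assms u] finite_component[OF assms u] finite_V card_mono
        by (auto intro: card_Diff_subset)
      thus "(\<Sum>v\<in>V - component E u. ?f u) = real (card V) * ?f u - 1"
        using card_component_pos[OF assms u] by (simp add: of_nat_diff field_simps)
    qed
    also have "\<dots> = real (card V) * (\<Sum>u\<in>V. ?f u) - real (card V)"
      by (simp add: sum_subtractf sum_distrib_left)
    finally show ?thesis by (simp only: sum_inverse_card_component[OF assms]) (simp add: algebra_simps)
  qed
  have "(\<Sum>(u, v)\<in>separated E. ?f v) = (\<Sum>(u, v)\<in>separated E. ?f u)"
    by (rule sum.reindex_bij_witness[where i = prod.swap and j = prod.swap])
       (auto simp: separated_def dest: component_sym)
  thus ?thesis using half by (simp add: case_prod_unfold sum.distrib)
qed

lemma card_separated_edges: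
  assumes E: "forest E" and T: "T \<in> trees_containing E"
  shows "real (card {(u, v) \<in> separated E. {u, v} \<in> T}) = 2 * (real (card (components V E)) - 1)"
proof -
  have T': "forest T" "E \<subseteq> T" "card (components V T) = 1"
    using T by (auto simp: trees_containing_def tree_def)
  \<comment> \<open>Edges of \<open>E\<close> stay within a component of \<open>E\<close>, while
    every other edge of \<open>T\<close> leaves one because it is a bridge of
    \<open>T\<close>.\<close>
  have "{(u, v) \<in> separated E. {u, v} \<in> T} = {(u, v). {u, v} \<in> T - E}"
    using T' component_edge bridged_new_edge[of T E]
    by (fastforce simp: separated_def forest_def all_edges_doubleton)
  also have "card \<dots> = 2 * card (T - E)"
    using T' by (intro card_edge_orientations) (auto simp: forest_def)
  finally have card_sep: "card {(u, v) \<in> separated E. {u, v} \<in> T} = 2 * card (T - E)" .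
  moreover have "card (T - E) + card E = card T"
    using T' finite_forest by (metis card_Diff_subset card_mono finite_subset le_add_diff_inverse2)
  ultimately have "card (components V E) = Suc (card (T - E))"
    using card_forest[OF E] card_forest[OF T'(1)] T'(3) by linarith
  with card_sep show ?thesis by simp
qed

text \<open>Counts the pairs of a tree containing \<open>E\<close> and an oriented edge of it
  between two components of \<open>E\<close>, first by the tree and then by the edge.\<close>

lemma trees_containing_double_count:
  assumes E: "forest E"
  shows "2 * (real (card (components V E)) - 1) * real (card (trees_containing E)) =
           (\<Sum>(u, v)\<in>separated E. real (card (trees_containing (insert {u, v} E))))"
proof -
  have fs: "finite (separated E)" unfolding separated_def using finite_V by auto
  have "2 * (real (card (components V E)) - 1) * real (card (trees_containing E)) =
      (\<Sum>T\<in>trees_containing E. real (card {(u, v) \<in> separated E. {u, v} \<in> T}))"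
    using card_separated_edges[OF E] by simp
  also have "\<dots> = (\<Sum>T\<in>trees_containing E. \<Sum>p\<in>{p\<in>separated E. {fst p, snd p} \<in> T}. 1)"
    by (simp add: case_prod_unfold)
  also have "\<dots> = (\<Sum>p\<in>separated E. \<Sum>T\<in>{T\<in>trees_containing E. {fst p, snd p} \<in> T}. 1)"
    by (rule sum.swap_restrict[OF finite_trees_containing fs])
  also have "\<dots> = (\<Sum>p\<in>separated E. real (card (trees_containing (insert {fst p, snd p} E))))"
  proof (rule sum.cong[OF refl])
    fix p
    have "{T\<in>trees_containing E. {fst p, snd p} \<in> T} = trees_containing (insert {fst p, snd p} E)"
      by (auto simp: trees_containing_def)
    thus "(\<Sum>T\<in>{T\<in>trees_containing E. {fst p, snd p} \<in> T}. 1) =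
        real (card (trees_containing (insert {fst p, snd p} E)))" by simp
  qed
  finally show ?thesis by (simp add: case_prod_unfold)
qed

text \<open>Induction on the number of components through the double count. Dividing by
  \<open>card V ^ 2\<close> in the reals avoids the exponent \<open>-1\<close> that a single
  component would give. With \<open>E = {}\<close> this is Cayley's formula.\<close>

theorem card_trees_containing:
  assumes "V \<noteq> {}" "forest E"
  shows "real (card (trees_containing E)) =
           real (card V) ^ card (components V E) * real (size_prod E) / real (card V) ^ 2"
  using assms(2)
proof (induction "card (components V E)" arbitrary: E)
  case 0
  thus ?case using assms(1) finite_components[of E] by (simp add: components_def)
next
  case (Suc m)
  have n: "real (card V) > 0" using assms(1) finite_V by (simp add: card_gt_0_iff)
  have sub: "E \<subseteq> all_edges V" using Suc.prems by (simp add: forest_def)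
  show ?case
  proof (cases "m = 0")
    \<comment> \<open>For one component the double count reads 0 = 0, so this case is direct: a tree
      containing \<open>E\<close> has as many edges as \<open>E\<close>, hence equals it, and the
      only component is \<open>V\<close>.\<close>
    case True
    hence 1: "card (components V E) = 1" using Suc.hyps by simp
    have "T = E" if "T \<in> trees_containing E" for T
    proof -
      have T: "forest T" "E \<subseteq> T" "card (components V T) = 1"
        using that by (auto simp: trees_containing_def tree_def)
      thus ?thesis using card_forest[OF T(1)] card_forest[OF Suc.prems] 1 finite_forest[OF T(1)]
        by (metis add_right_cancel card_subset_eq)
    qed
    hence "trees_containing E = {E}" using Suc.prems 1 by (auto simp: trees_containing_def tree_def)
    moreover obtain w where w: "w \<in> V" using assms(1) by blast
    have "components V E = {component E w}"
      using 1 w by (metis card_1_singletonE components_def imageI singletonD)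
    moreover from this have "component E w = V"
      using component_subset_V[OF sub w] component_eq_iff component_self
      by (metis components_def imageI singletonD subsetI subset_antisym)
    ultimately show ?thesis using n by (simp add: size_prod_def power2_eq_square)
  next
    case False
    let ?c = "\<lambda>u. real (card (component E u))"
    let ?K = "real (card V) ^ m * real (size_prod E) / real (card V) ^ 2"
    have "2 * real m * real (card (trees_containing E)) =
        (\<Sum>(u, v)\<in>separated E. real (card (trees_containing (insert {u, v} E))))"
      using trees_containing_double_count[OF Suc.prems] Suc.hyps(2)[symmetric] by simp
    \<comment> \<open>By the induction hypothesis; \<open>1 / a + 1 / b\<close> is the ratio
      \<open>(a + b) / (a * b)\<close> by which the size product changes.\<close>
    also have "\<dots> = (\<Sum>(u, v)\<in>separated E. ?K * (1 / ?c u + 1 / ?c v))"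
    proof (rule sum.cong[OF refl], clarsimp simp del: of_nat_power)
      fix u v assume "(u, v) \<in> separated E"
      hence uv: "u \<in> V" "v \<in> V" "v \<notin> component E u" by (auto simp: separated_def)
      have c: "?c u > 0" "?c v > 0" using card_component_pos[OF sub] uv by auto
      have m: "m = card (components V (insert {u, v} E))"
        using card_components_insert[OF uv] Suc.hyps(2) by simp
      have "real (size_prod (insert {u, v} E)) * (?c u * ?c v) = real (size_prod E) * (?c u + ?c v)"
        using size_prod_insert[OF sub uv] by (metis of_nat_add of_nat_mult)
      hence "real (size_prod (insert {u, v} E)) = real (size_prod E) * (1 / ?c u + 1 / ?c v)"
        using c by (simp add: field_simps)
      thus "real (card (trees_containing (insert {u, v} E))) = real (card V) ^ m * real (size_prod E) *
          (1 / ?c u + 1 / ?c v) / (real (card V))\<^sup>2"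
        using Suc.hyps(1)[OF m forest_insert[OF Suc.prems uv]] m by simp
    qed
    also have "\<dots> = ?K * (\<Sum>(u, v)\<in>separated E. 1 / ?c u + 1 / ?c v)"
      by (simp add: case_prod_unfold sum_distrib_left)
    also have "\<dots> = ?K * (2 * real (card V) * real m)"
      by (simp only: sum_separated[OF sub]) (simp add: Suc.hyps(2)[symmetric])
    finally have "2 * real m * real (card (trees_containing E)) = 2 * real m * (?K * real (card V))"
      by (simp only: mult_ac)
    hence "real (card (trees_containing E)) = ?K * real (card V)"
      using False by (subst (asm) mult_left_cancel) auto
    thus ?thesis using Suc.hyps(2)[symmetric] by (simp add: mult_ac)
  qed
qed

subsection \<open>Trees avoiding a star\<close>

definition trees_between :: "'a set set \<Rightarrow> 'a set set \<Rightarrow> 'a set set set" where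
  "trees_between E D = {T \<in> trees_containing E. T \<inter> D = {}}"

lemma trees_between_empty [simp]: "trees_between E {} = trees_containing E"
  by (simp add: trees_between_def)

text \<open>A tree avoiding \<open>D\<close> either avoids \<open>e\<close> as well or contains
  it.\<close>

lemma card_trees_between_insert:
  "real (card (trees_between E (insert e D))) =
     real (card (trees_between E D)) - real (card (trees_between (insert e E) D))"
proof -
  have "trees_between E D = trees_between E (insert e D) \<union> trees_between (insert e E) D"
    "trees_between E (insert e D) \<inter> trees_between (insert e E) D = {}"
    by (auto simp: trees_between_def trees_containing_def)
  moreover have "finite (trees_between F D')" for F D'
    using finite_trees_containing by (simp add: trees_between_def)
  ultimately show ?thesis by (simp add: card_Un_disjoint)
qed

definition star :: "'a \<Rightarrow> 'a set \<Rightarrow> 'a set set" where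
  "star r A = (\<lambda>a. {r, a}) ` A"

lemma star_empty [simp]: "star r {} = {}"
  by (simp add: star_def)

lemma star_insert: "star r (insert a A) = insert {r, a} (star r A)"
  by (simp add: star_def)

text \<open>The isolated vertices of \<open>A\<close> are attached to \<open>r\<close> one at a
  time. The ratios of successive size products telescope to \<open>(c + card A) / c\<close>, where
  \<open>c\<close> is the size of the component of \<open>r\<close> in \<open>E\<close>. The clause
  on singleton components says that vertices not yet attached remain isolated, which the next step
  of the induction uses.\<close>

lemma forest_star:
  assumes "finite A" "forest E" "r \<in> V" "A \<subseteq> V" "A \<inter> component E r = {}"
    and "\<And>a. a \<in> A \<Longrightarrow> component E a = {a}"
  shows "forest (E \<union> star r A) \<and> component (E \<union> star r A) r = component E r \<union> A \<and>
    (\<forall>w. component E w = {w} \<and> w \<notin> A \<and> w \<notin> component E r \<longrightarrow> component (E \<union> star r A) w = {w}) \<and>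
    card (components V (E \<union> star r A)) + card A = card (components V E) \<and>
    real (size_prod (E \<union> star r A)) = real (size_prod E) * (1 + real (card A) / real (card (component E r)))"
  using assms(1,4,5,6)
proof (induction A)
  case empty
  thus ?case using assms(2) by simp
next
  case (insert a A)
  define F where "F = E \<union> star r A"
  have IH: "forest F" "component F r = component E r \<union> A"
      "\<And>w. component E w = {w} \<Longrightarrow> w \<notin> A \<Longrightarrow> w \<notin> component E r \<Longrightarrow> component F w = {w}"
      "card (components V F) + card A = card (components V E)"
      "real (size_prod F) = real (size_prod E) * (1 + real (card A) / real (card (component E r)))"
    using insert by (auto simp: F_def)
  have F': "E \<union> star r (insert a A) = insert {r, a} F" by (auto simp: F_def star_insert)
  have a: "a \<in> V" "a \<notin> component F r" "component F a = {a}"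
    using insert.prems insert.hyps IH(2) IH(3)[of a] by auto
  have sub: "F \<subseteq> all_edges V" "E \<subseteq> all_edges V" using IH(1) assms(2) by (auto simp: forest_def)
  have pos: "card (component E r) > 0" using card_component_pos[OF sub(2) assms(3)] .
  have cr: "card (component F r) = card (component E r) + card A"
    unfolding IH(2) using insert.prems insert.hyps finite_component[OF sub(2) assms(3)]
    by (intro card_Un_disjoint) auto
  have "forest (insert {r, a} F)" by (rule forest_insert[OF IH(1) assms(3) a(1,2)])
  moreover have "component (insert {r, a} F) r = component E r \<union> insert a A"
    by (auto simp: component_insert_endpoint a(3) IH(2))
  moreover have "component (insert {r, a} F) w = {w}"
    if "component E w = {w}" "w \<notin> insert a A" "w \<notin> component E r" for w
    using that IH(2,3) a(3) by (subst component_insert) auto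
  moreover have "card (components V (insert {r, a} F)) + card (insert a A) = card (components V E)"
    using card_components_insert[OF assms(3) a(1,2)] IH(4) insert.hyps by simp
  moreover have "real (size_prod (insert {r, a} F)) =
      real (size_prod E) * (1 + real (card (insert a A)) / real (card (component E r)))"
  proof -
    have "real (size_prod (insert {r, a} F)) * real (card (component F r)) =
        real (size_prod F) * (real (card (component F r)) + 1)"
      using size_prod_insert[OF sub(1) assms(3) a(1,2)] a(3)
      by (metis (no_types, lifting) One_nat_def card.empty card.insert empty_iff finite.emptyI mult_1_right of_nat_1 of_nat_add of_nat_mult)
    moreover define x y where x_y_def: "x = real (card (component E r))" "y = real (card A)"
    moreover have "x > 0" "y \<ge> 0" using pos by (simp_all add: x_y_def)
    ultimately have "real (size_prod (insert {r, a} F)) =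
        real (size_prod E) * (1 + y / x) * (x + y + 1) / (x + y)"
      using cr IH(5) by (simp add: eq_divide_eq)
    \<comment> \<open>The telescoping: \<open>1 + y / x\<close> is \<open>(x + y) / x\<close>, and
      \<open>x + y\<close> cancels.\<close>
    also have "\<dots> = real (size_prod E) * (1 + (y + 1) / x)"
      using \<open>x > 0\<close> \<open>y \<ge> 0\<close> by (simp add: divide_simps)
    finally show ?thesis using insert.hyps by (simp add: x_y_def add.commute)
  qed
  ultimately show ?case unfolding F' by (intro conjI allI impI) simp_all
qed

text \<open>\<open>A\<close> holds the prescribed and \<open>B\<close> the forbidden leaves at
  \<open>r\<close>. Induction on \<open>B\<close> with \<open>A\<close> arbitrary, because releasing
  a forbidden leaf subtracts the trees in which it is prescribed. Each forbidden leaf costs a factor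
  \<open>(N - 1) / N\<close> and lowers the last factor by \<open>1 / (c * (N - 1))\<close>.\<close>

lemma card_trees_between_star:
  fixes E A B r
  defines "N \<equiv> real (card V)" and "c \<equiv> real (card (component E r))"
  assumes "forest E" "r \<in> V" "card V \<ge> 2"
    and "finite A" "finite B" "A \<union> B \<subseteq> V" "A \<inter> B = {}" "(A \<union> B) \<inter> component E r = {}"
    and "\<And>a. a \<in> A \<union> B \<Longrightarrow> component E a = {a}"
  shows "real (card (trees_between (E \<union> star r A) (star r B))) =
    N ^ card (components V E) * real (size_prod E) / N ^ 2 * (N - 1) ^ card B / N ^ (card A + card B) *
      (1 + real (card A) / c - real (card B) / (c * (N - 1)))"
  using assms(7,6,8-11)
proof (induction B arbitrary: A)
  case empty
  have star: "forest (E \<union> star r A)"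
      "card (components V (E \<union> star r A)) + card A = card (components V E)"
      "real (size_prod (E \<union> star r A)) = real (size_prod E) * (1 + real (card A) / c)"
    using forest_star[of A E r] assms(3,4) empty unfolding c_def by simp_all
  have "V \<noteq> {}" using assms(4) by blast
  have "N > 0" using assms(5) by (simp add: N_def)
  hence "N ^ card (components V (E \<union> star r A)) = N ^ card (components V E) / N ^ card A"
    by (simp flip: star(2) add: power_add)
  thus ?case using card_trees_containing[OF \<open>V \<noteq> {}\<close> star(1)] star(3)
    by (simp add: N_def mult.commute)
next
  case (insert x B)
  define K where "K = N ^ card (components V E) * real (size_prod E) / N ^ 2"
  define Q where "Q = K * (N - 1) ^ card B / N ^ (card A + card B)"
  define y where "y = 1 + real (card A) / c - real (card B) / (c * (N - 1))"
  have N: "N > 1" using assms(5) by (simp add: N_def)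
  have c: "c > 0" unfolding c_def using assms(3,4) card_component_pos by (simp add: forest_def)
  have x: "x \<notin> A" using insert.prems by auto
  have "real (card (trees_between (E \<union> star r A) (star r (insert x B)))) =
      real (card (trees_between (E \<union> star r A) (star r B))) -
      real (card (trees_between (E \<union> star r (insert x A)) (star r B)))"
    by (simp add: star_insert card_trees_between_insert)
  also have "real (card (trees_between (E \<union> star r A) (star r B))) = Q * y"
    using insert.prems unfolding Q_def K_def y_def by (intro insert.IH) auto
  also have "real (card (trees_between (E \<union> star r (insert x A)) (star r B))) =
      K * (N - 1) ^ card B / N ^ (card (insert x A) + card B) *
      (1 + real (card (insert x A)) / c - real (card B) / (c * (N - 1)))"
    unfolding K_def by (rule insert.IH) (use insert.prems insert.hyps in auto)
  \<comment> \<open>Moving \<open>x\<close> into the prescribed leaves merges two components, which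
    costs a factor \<open>N\<close>, and raises the linear factor by \<open>1 / c\<close>.\<close>
  also have "\<dots> = Q / N * (y + 1 / c)"
  proof -
    have "1 + real (card (insert x A)) / c - real (card B) / (c * (N - 1)) = y + 1 / c"
      using insert.prems x by (simp add: y_def add_divide_distrib)
    thus ?thesis using insert.prems x by (simp add: Q_def mult_ac)
  qed
  also have "Q * y - Q / N * (y + 1 / c) = Q * (N - 1) / N * (y - 1 / (c * (N - 1)))"
    using N c by (simp add: divide_simps) (simp add: algebra_simps)
  also have "y - 1 / (c * (N - 1)) = 1 + real (card A) / c - real (card (insert x B)) / (c * (N - 1))"
    using insert.hyps by (simp add: y_def add_divide_distrib)
  also have "Q * (N - 1) / N = K * (N - 1) ^ card (insert x B) / N ^ (card A + card (insert x B))"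
    using insert.hyps by (simp add: Q_def mult_ac)
  finally show ?case unfolding K_def .
qed

subsection \<open>Trees as acyclic connected graphs\<close>

lemma card_components_eq_1_iff:
  assumes "V \<noteq> {}"
  shows "card (components V E) = 1 \<longleftrightarrow> (\<forall>u\<in>V. \<forall>v\<in>V. v \<in> component E u)"
proof
  assume "card (components V E) = 1"
  then obtain C where "components V E = {C}" by (auto simp: card_1_singleton_iff)
  hence "component E u = C" if "u \<in> V" for u using that by (auto simp: components_def)
  thus "\<forall>u\<in>V. \<forall>v\<in>V. v \<in> component E u" using component_self by metis
next
  assume *: "\<forall>u\<in>V. \<forall>v\<in>V. v \<in> component E u"
  obtain w where "w \<in> V" using assms by blast
  hence "component E u = component E w" if "u \<in> V" for u using * that by (simp add: component_eq_iff)
  hence "components V E = {component E w}" using \<open>w \<in> V\<close> unfolding components_def by blast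
  thus "card (components V E) = 1" by simp
qed

text \<open>A cycle through an edge is the same as a simple path between its ends that avoids
  it.\<close>

lemma acyclic_iff_bridged:
  assumes "E \<subseteq> all_edges V"
  shows "(\<nexists>p. graph_cycle (V, E) p) \<longleftrightarrow> bridged E"
proof
  assume acyclic: "\<nexists>p. graph_cycle (V, E) p"
  show "bridged E"
    unfolding bridged_def
  proof (intro allI impI notI)
    fix u v assume uv: "{u, v} \<in> E" "v \<in> component (E - {{u, v}}) u"
    obtain p where p: "p \<noteq> []" "hd p = u" "last p = v" "distinct p"
      "successively (\<lambda>x y. {x, y} \<in> E - {{u, v}}) p" "set p \<subseteq> component (E - {{u, v}}) u"
      using component_path[OF uv(2)] .
    have V: "u \<in> V" "u \<noteq> v" using uv(1) assms all_edges_doubleton[of u v V] by auto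
    have "set p \<subseteq> V" using p(6) component_subset_V[of "E - {{u, v}}" u] assms V by blast
    \<comment> \<open>One vertex would force \<open>u = v\<close>, and two would make the path use
      the removed edge.\<close>
    moreover have "3 \<le> length p"
    proof (rule ccontr)
      assume "\<not> 3 \<le> length p"
      moreover have "length p \<noteq> 0" using p(1) by simp
      ultimately have "length p = 1 \<or> length p = 2" by linarith
      then consider a where "p = [a]" | a b where "p = [a, b]"
        by (auto simp: length_Suc_conv numeral_2_eq_2)
      thus False using p V by cases auto
    qed
    moreover have "successively (\<lambda>x y. {x, y} \<in> E) p"
      using p(5) by (rule successively_mono) auto
    ultimately have "graph_cycle (V, E) p"
      using p uv by (simp add: graph_cycle_def graph_walk_def insert_commute)
    thus False using acyclic by blast
  qed
next
  assume bridged: "bridged E"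
  show "\<nexists>p. graph_cycle (V, E) p"
  proof
    assume "\<exists>p. graph_cycle (V, E) p"
    then obtain p where p: "p \<noteq> []" "successively (\<lambda>x y. {x, y} \<in> E) p" "3 \<le> length p"
      "distinct p" "{last p, hd p} \<in> E" by (auto simp: graph_cycle_def graph_walk_def)
    have "successively (\<lambda>x y. {x, y} \<in> E - {{hd p, last p}}) p"
      unfolding successively_conv_nth
    proof (intro allI impI)
      fix i assume i: "Suc i < length p"
      \<comment> \<open>Since the vertices are distinct, equality would make 0 and
        \<open>length p - 1\<close> consecutive indices, which length at least 3 excludes.\<close>
      have "{p ! i, p ! Suc i} \<noteq> {p ! 0, p ! (length p - 1)}"
        using i p(1,3,4) by (auto simp: doubleton_eq_iff nth_eq_iff_index_eq)
      thus "{p ! i, p ! Suc i} \<in> E - {{hd p, last p}}"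
        using p(1,2) i by (simp add: successively_conv_nth hd_conv_nth last_conv_nth)
    qed
    hence "last p \<in> component (E - {{hd p, last p}}) (hd p)" by (rule walk_component[OF p(1)])
    moreover have "{hd p, last p} \<in> E" using p(5) by (simp add: insert_commute)
    ultimately show False using bridged unfolding bridged_def by blast
  qed
qed

lemma graph_tree_iff_tree:
  assumes "V \<noteq> {}"
  shows "graph_tree (V, E) \<longleftrightarrow> tree E"
proof (cases "E \<subseteq> all_edges V")
  case True
  have "graph_connected (V, E) \<longleftrightarrow> (\<forall>u\<in>V. \<forall>v\<in>V. v \<in> component E u)"
  proof -
    have "(\<exists>p. graph_walk (V, E) p \<and> hd p = u \<and> last p = v) \<longleftrightarrow> v \<in> component E u"
      if "u \<in> V" for u v
    proof
      assume "v \<in> component E u"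
      then obtain p where "p \<noteq> []" "hd p = u" "last p = v" "distinct p"
        "successively (\<lambda>x y. {x, y} \<in> E) p" "set p \<subseteq> component E u" by (rule component_path)
      thus "\<exists>p. graph_walk (V, E) p \<and> hd p = u \<and> last p = v"
        using component_subset_V[OF True that] by (auto simp: graph_walk_def)
    next
      assume "\<exists>p. graph_walk (V, E) p \<and> hd p = u \<and> last p = v"
      thus "v \<in> component E u" using walk_component by (auto simp: graph_walk_def)
    qed
    thus ?thesis using assms by (simp add: graph_connected_def)
  qed
  moreover have "simple_graph (V, E)"
    using True finite_V by (auto simp: simple_graph_def all_edges_def)
  ultimately show ?thesis
    using True acyclic_iff_bridged[OF True] card_components_eq_1_iff[OF assms]
    by (auto simp: graph_tree_def tree_def forest_def)
next
  case False
  thus ?thesis by (auto simp: graph_tree_def tree_def forest_def simple_graph_def all_edges_def)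
qed

subsection \<open>Forbidding one more edge\<close>

text \<open>All trees minus those containing the edge. The edge is a star with one leaf, so
  \<open>forest_star\<close> supplies its component count and size product.\<close>

lemma card_trees_avoiding_edge:
  fixes x z
  defines "N \<equiv> real (card V)"
  assumes "x \<in> V" "z \<in> V" "x \<noteq> z"
  shows "real (card (trees_between {} {{x, z}})) = N ^ card V / N ^ 2 - N ^ (card V - 1) * 2 / N ^ 2"
proof -
  have "V \<noteq> {}" using assms by blast
  have e: "forest {{x, z}}" "card (components V {{x, z}}) = card V - 1" "size_prod {{x, z}} = 2"
    using forest_star[of "{z}" "{}" x] assms card_components_empty size_prod_empty
    by (simp_all add: star_def) linarith
  show ?thesis
    using card_trees_between_insert[of "{}" "{x, z}" "{}"]
      card_trees_containing[OF \<open>V \<noteq> {}\<close> forest_empty]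
      card_trees_containing[OF \<open>V \<noteq> {}\<close> e(1)] e(2,3)
    by (simp add: N_def card_components_empty size_prod_empty)
qed

text \<open>The first line counts the trees avoiding the star; those containing
  \<open>{x, z}\<close> are subtracted. Once \<open>{x, z}\<close> is prescribed, \<open>z\<close>
  is no longer isolated and the star formula does not cover the leaf \<open>z\<close>, so
  \<open>{r, z}\<close> is split off: trees containing \<open>{x, z}\<close> minus trees containing
  the path through \<open>x\<close>, \<open>z\<close>, \<open>r\<close>, both avoiding
  \<open>star r S\<close>. The component of \<open>r\<close> has size 1 in the first two counts and
  3 in the last.\<close>

lemma card_trees_avoiding_edge_star:
  fixes x z r S
  defines "N \<equiv> real (card V)"
  assumes "x \<in> V" "z \<in> V" "r \<in> V" "distinct [x, z, r]" "S \<subseteq> V - {x, z, r}"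
  shows "real (card (trees_between {} (insert {x, z} (star r (insert z S))))) =
    N ^ card V / N ^ 2 * (N - 1) ^ Suc (card S) / N ^ Suc (card S) * (1 - real (Suc (card S)) / (N - 1))
    - (N ^ (card V - 1) * 2 / N ^ 2 * (N - 1) ^ card S / N ^ card S * (1 - real (card S) / (N - 1))
       - N ^ (card V - 2) * 3 / N ^ 2 * (N - 1) ^ card S / N ^ card S * (1 - real (card S) / (3 * (N - 1))))"
proof -
  let ?F = "{{x, z}}" and ?H = "{{r, z}, {x, z}}"
  have S: "finite S" "z \<notin> S" "S \<subseteq> V" "x \<notin> S" "r \<notin> S" using assms finite_V finite_subset by auto
  have "card {x, z, r} \<le> card V" using assms finite_V by (intro card_mono) auto
  hence V3: "card V \<ge> 3" using assms by simp
  have F: "forest ?F" "component ?F x = {x, z}" "card (components V ?F) = card V - 1" "size_prod ?F = 2"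
    "\<And>w. w \<notin> {x, z} \<Longrightarrow> component ?F w = {w}"
    using forest_star[of "{z}" "{}" x] assms V3 card_components_empty size_prod_empty
    by (auto simp: star_def insert_commute)
  \<comment> \<open>Seen from its middle vertex \<open>z\<close>, the path is a star, so
    \<open>forest_star\<close> applies to it.\<close>
  have "star z {x, r} = ?H" by (auto simp: star_def insert_commute)
  hence H: "forest ?H" "component ?H z = {x, z, r}" "card (components V ?H) = card V - 2" "size_prod ?H = 3"
    "\<And>w. w \<notin> {x, z, r} \<Longrightarrow> component ?H w = {w}"
    using forest_star[of "{x, r}" "{}" z] assms V3 card_components_empty size_prod_empty
    by (auto simp: insert_commute)
  have Hr: "component ?H r = {x, z, r}"
    using H(2) component_eq_iff[of ?H z r] by simp
  have "real (card (trees_between {} (star r (insert z S)))) =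
      N ^ card V / N ^ 2 * (N - 1) ^ Suc (card S) / N ^ Suc (card S) * (1 - real (Suc (card S)) / (N - 1))"
  proof -
    have "r \<noteq> z" using assms(5) by auto
    thus ?thesis using card_trees_between_star[of "{}" r "{}" "insert z S"] S V3 assms(2-4)
      by (simp add: card_components_empty size_prod_empty N_def)
  qed
  moreover have "real (card (trees_between ?F (star r S))) =
      N ^ (card V - 1) * 2 / N ^ 2 * (N - 1) ^ card S / N ^ card S * (1 - real (card S) / (N - 1))"
  proof -
    have "component ?F r = {r}" using assms(5) by (intro F(5)) auto
    moreover have "component ?F a = {a}" if "a \<in> {} \<union> S" for a
      using that S by (intro F(5)) auto
    ultimately show ?thesis
      using card_trees_between_star[of ?F r "{}" S] S V3 assms(4) F(1,3,4) by (simp add: N_def)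
  qed
  moreover have "real (card (trees_between ?H (star r S))) =
      N ^ (card V - 2) * 3 / N ^ 2 * (N - 1) ^ card S / N ^ card S * (1 - real (card S) / (3 * (N - 1)))"
  proof -
    have "component ?H a = {a}" if "a \<in> {} \<union> S" for a
      using that S by (intro H(5)) auto
    moreover have "card {x, z, r} = 3" using assms(5) by simp
    ultimately show ?thesis
      using card_trees_between_star[of ?H r "{}" S] S V3 assms(4) H(1,3,4) Hr by (simp add: N_def)
  qed
  ultimately show ?thesis
    by (simp only: card_trees_between_insert[of _ "{x, z}"] star_insert card_trees_between_insert[of ?F "{r, z}"])
qed

end

section \<open>From uprooted trees to forbidden edges, and the final evaluation\<close>

lemma uprooted_spanning_trees_eq:
  fixes n r :: nat
  assumes "r \<in> {1..n}"
  shows "uprooted_spanning_trees (delete_edge (complete_graph n) {1, n}) r =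
    Pair {1..n} ` vertex_set.trees_between {1..n} {} (insert {1, n} (vertex_set.star r {r<..n}))"
proof -
  interpret vertex_set "{1..n}" by unfold_locales simp
  have "uprooted_spanning_tree (delete_edge (complete_graph n) {1, n}) (U, E) r \<longleftrightarrow>
      U = {1..n} \<and> E \<in> trees_between {} (insert {1, n} (star r {r<..n}))" for U E
  proof -
    have "uprooted_spanning_tree (delete_edge (complete_graph n) {1, n}) (U, E) r \<longleftrightarrow>
        U = {1..n} \<and> graph_tree ({1..n}, E) \<and> E \<subseteq> all_edges {1..n} - {{1, n}} \<and>
        (\<forall>v\<in>{1..n}. {r, v} \<in> E \<longrightarrow> v < r)"
      using assms by (auto simp: uprooted_spanning_tree_def spanning_tree_of_def delete_edge_def
          complete_graph_def all_edges_def simp del: One_nat_def)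
    moreover have "graph_tree ({1..n}, E) \<longleftrightarrow> tree E"
      by (rule graph_tree_iff_tree) (use assms in auto)
    moreover have "tree E \<Longrightarrow> E \<subseteq> all_edges {1..n}"
      unfolding tree_def forest_def by blast
    moreover have "(\<forall>v\<in>{1..n}. {r, v} \<in> E \<longrightarrow> v < r) \<longleftrightarrow> E \<inter> star r {r<..n} = {}"
      if "E \<subseteq> all_edges {1..n}"
    proof -
      \<comment> \<open>Excludes the loop at \<open>r\<close>: the condition \<open>v < r\<close>
        fails at \<open>v = r\<close> too, but the star only forbids larger neighbours.\<close>
      have sub: "v \<in> {1..n} \<and> r \<noteq> v" if "{r, v} \<in> E" for v
        using that \<open>E \<subseteq> all_edges {1..n}\<close> all_edges_doubleton[of r v "{1..n}"] by blast
      have "E \<inter> star r {r<..n} = {} \<longleftrightarrow> (\<forall>v\<in>{r<..n}. {r, v} \<notin> E)"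
        unfolding star_def by blast
      also have "\<dots> \<longleftrightarrow> (\<forall>v\<in>{1..n}. {r, v} \<in> E \<longrightarrow> v < r)"
      proof (intro iffI ballI impI)
        fix v assume "\<forall>v\<in>{r<..n}. {r, v} \<notin> E" "v \<in> {1..n}" "{r, v} \<in> E"
        thus "v < r" using sub[of v] by (meson atLeastAtMost_iff greaterThanAtMost_iff linorder_neqE_nat)
      next
        fix v assume "\<forall>v\<in>{1..n}. {r, v} \<in> E \<longrightarrow> v < r" "v \<in> {r<..n}"
        thus "{r, v} \<notin> E" by force
      qed
      finally show ?thesis by simp
    qed
    ultimately show ?thesis
      unfolding trees_between_def trees_containing_def by blast
  qed
  thus ?thesis by (auto simp: uprooted_spanning_trees_def image_iff)
qed

theorem theorem5p1:
  fixes n :: nat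
  assumes "n \<ge> 3"
  defines "G \<equiv> delete_edge (complete_graph n) {1, n}"
  shows "card (uprooted_spanning_trees G n) = n ^ (n - 3) * (n - 2) \<and>
    (\<forall>k::nat. 1 \<le> k \<and> k \<le> n - 2 \<longrightarrow>
       real (card (uprooted_spanning_trees G (n - k))) =
         real n ^ (n - 2 - k) * (real n - 1) ^ (k - 1) *
         ((real n - 3 - real k) +
          (2 * real n * real k + real n - real k - 2) / (real n * (real n - 1))))"
proof -
  interpret vertex_set "{1..n}" by unfold_locales simp
  have V: "card {1..n} = n" "{1..n} \<noteq> {}" using assms(1) by auto
  have card_eq: "card (uprooted_spanning_trees G r) =
      card (trees_between {} (insert {1, n} (star r {r<..n})))" if "r \<in> {1..n}" for r
    unfolding G_def uprooted_spanning_trees_eq[OF that] by (intro card_image inj_onI) auto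
  have split: "real (card (trees_between {} (insert {1, n} D))) =
      real (card (trees_between {} D)) - real (card (trees_between {{1, n}} D))" for D
    by (rule card_trees_between_insert)
  have "card (uprooted_spanning_trees G n) = n ^ (n - 3) * (n - 2)"
  proof -
    \<comment> \<open>The root \<open>n\<close> has an empty star, so only \<open>{1, n}\<close> is
      forbidden; \<open>m\<close> replaces the truncated exponent \<open>n - 3\<close>.\<close>
    obtain m where m: "n = m + 3" using assms(1) by (metis le_add_diff_inverse2)
    have "real (card (uprooted_spanning_trees G n)) = real n ^ n / real n ^ 2 - real n ^ (n - 1) * 2 / real n ^ 2"
      using card_eq[of n] card_trees_avoiding_edge[of 1 n] assms(1) by simp
    also have "\<dots> = real n ^ m * (real n - 2)"
    proof -
      have "n - 1 = m + 2" using m by simp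
      moreover have "real n ^ n = real n ^ m * real n ^ 3" by (subst (2) m) (rule power_add)
      ultimately show ?thesis
        using assms(1) by (simp add: power_add power2_eq_square power3_eq_cube right_diff_distrib)
    qed
    also have "\<dots> = real (n ^ (n - 3) * (n - 2))" using m by (simp add: distrib_left)
    finally show ?thesis by (simp only: of_nat_eq_iff)
  qed
  moreover have "real (card (uprooted_spanning_trees G (n - k))) =
         real n ^ (n - 2 - k) * (real n - 1) ^ (k - 1) *
         ((real n - 3 - real k) +
          (2 * real n * real k + real n - real k - 2) / (real n * (real n - 1)))"
    if k: "1 \<le> k" "k \<le> n - 2" for k
  proof -
    obtain s where s: "k = Suc s" using k by (cases k) auto
    \<comment> \<open>\<open>m\<close> and \<open>s\<close> are the exponents of \<open>n\<close>
      and \<open>n - 1\<close> in the claim.\<close>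
    define m where "m = n - k - 2"
    have m: "n = m + s + 3" using k assms(1) s by (simp add: m_def)
    \<comment> \<open>The forbidden edge \<open>{1, n}\<close> meets the star of \<open>r\<close> in
      the leaf \<open>n\<close>; \<open>S\<close> collects the other \<open>k - 1\<close> leaves.
      The bounds on \<open>k\<close> keep \<open>r\<close> strictly between 1 and
      \<open>n\<close>.\<close>
    define r S where "r = n - k" and "S = {r<..<n}"
    have r: "r \<in> {1..n}" "{r<..n} = insert n S" "S \<subseteq> {1..n} - {1, n, r}" "distinct [1, n, r]"
      using k assms(1) by (auto simp: r_def S_def)
    have cS: "card S = s" using m s by (simp add: S_def r_def)
    define N where "N = real n"
    have N: "N > 1" using m by (simp add: N_def)
    have factor: "p * a * x - (p * b * y - p * c * z) = p * (a * x - (b * y - c * z))"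
      for p a b c x y z :: real by (simp add: algebra_simps)
    have "real (card (uprooted_spanning_trees G r)) =
        N ^ n / N ^ 2 * (N - 1) ^ Suc s / N ^ Suc s * (1 - real (Suc s) / (N - 1))
        - (N ^ (n - 1) * 2 / N ^ 2 * (N - 1) ^ s / N ^ s * (1 - real s / (N - 1))
          - N ^ (n - 2) * 3 / N ^ 2 * (N - 1) ^ s / N ^ s * (1 - real s / (3 * (N - 1))))"
      using card_trees_avoiding_edge_star[of 1 n r S] r V cS assms(1)
      unfolding card_eq[OF r(1)] N_def by (simp only: r(2)) auto
    also have "N ^ n = N ^ m * N ^ s * N ^ 3" by (simp only: m power_add)
    also have "N ^ (n - 1) = N ^ m * N ^ s * N ^ 2" by (simp add: m power_add power2_eq_square)
    also have "N ^ (n - 2) = N ^ m * N ^ s * N" by (simp add: m power_add)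
    also have "N ^ m * N ^ s * N ^ 3 / N ^ 2 * (N - 1) ^ Suc s / N ^ Suc s = N ^ m * (N - 1) ^ s * (N - 1)"
      using N by (simp add: power2_eq_square power3_eq_cube)
    also have "N ^ m * N ^ s * N ^ 2 * 2 / N ^ 2 * (N - 1) ^ s / N ^ s = N ^ m * (N - 1) ^ s * 2"
      using N by simp
    also have "N ^ m * N ^ s * N * 3 / N ^ 2 * (N - 1) ^ s / N ^ s = N ^ m * (N - 1) ^ s * (3 / N)"
      using N by (simp add: power2_eq_square)
    also have "N ^ m * (N - 1) ^ s * (N - 1) * (1 - real (Suc s) / (N - 1)) -
        (N ^ m * (N - 1) ^ s * 2 * (1 - real s / (N - 1)) -
         N ^ m * (N - 1) ^ s * (3 / N) * (1 - real s / (3 * (N - 1)))) =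
        N ^ m * (N - 1) ^ s * ((N - 1) * (1 - real k / (N - 1)) -
          (2 * (1 - real s / (N - 1)) - 3 / N * (1 - real s / (3 * (N - 1)))))"
      by (simp only: s factor)
    \<comment> \<open>With the common factor \<open>N ^ m * (N - 1) ^ s\<close> removed, a rational
      identity in \<open>N\<close> and \<open>k\<close> remains, as
      \<open>s = k - 1\<close>.\<close>
    also have "(N - 1) * (1 - real k / (N - 1)) -
          (2 * (1 - real s / (N - 1)) - 3 / N * (1 - real s / (3 * (N - 1)))) =
        (N - 3 - real k) + (2 * N * real k + N - real k - 2) / (N * (N - 1))"
    proof -
      have "real s = real k - 1" by (simp add: s)
      thus ?thesis using N by (simp add: divide_simps) (simp add: algebra_simps)
    qed
    finally show ?thesis using m s by (simp add: N_def r_def)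
  qed
  ultimately show ?thesis by blast
qed

end
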